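(* Let $H$ be an infinite subgroup of a hyperbolic group $G$ and let $Q\subset G$ be a subset (not necessarily quasiconvex). Suppose that $H\subseteq P_1Q^{-1}QP_2$ for some finite subsets $P_1,P_2$ of $G$, and that there are a group $G_1$ and an epimorphism $\phi: G\to G_1$ such that $\phi$ is surjective on $H$ (i.e. $\phi(H)=G_1$) and $\phi|_Q$ is a quasiisometry between $Q$ and $\phi(Q)$. Then the subgroup $H$ is a quasiretract of $G$.
   Context: Hyperbolic means Gromov (word) hyperbolic. $G$ has a fixed finite symmetrized generating set $\mathcal A$ and the corresponding word metric $d$; the quotient $G_1$ is given the word metric $d_1$ of the generating set $\phi(\mathcal A)$. That $\phi|_Q$ is a quasiisometry between $Q$ and $\phi(Q)$ is meant with respect to the restrictions of these metrics: there are constants $K\ge 1$, $C\ge0$ with $K^{-1}d(u,v)-C\le d_1(\phi(u),\phi(v))\le K d(u,v)+C$ for all $u,v\in Q$. Products of subsets of $G$ are taken elementwise, and $Q^{-1}=\{q^{-1}\mid q\in Q\}$. A subgroup $H$ of a group $G$ is called a quasiretract of $G$ if there exists a normal subgroup $N\lhd G$ such that $|G:HN|<\infty$ and the intersection $H\cap N$ is finite. *)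

theory Defs
  imports Complex_Main "HOL-Algebra.Algebra"
begin

definition is_word :: "('a, 'm) monoid_scheme \<Rightarrow> 'a set \<Rightarrow> 'a list \<Rightarrow> 'a \<Rightarrow> bool" where
  "is_word G A ws g \<longleftrightarrow>
     set ws \<subseteq> A \<union> set_inv\<^bsub>G\<^esub> A \<and> foldr (\<otimes>\<^bsub>G\<^esub>) ws \<one>\<^bsub>G\<^esub> = g"

text \<open>If \<open>A\<close> is symmetrized, the words below are simply the words in the alphabet \<open>A\<close>.
  The value is meaningful only for elements of the subgroup generated by \<open>A\<close>.\<close>

definition word_length :: "('a, 'm) monoid_scheme \<Rightarrow> 'a set \<Rightarrow> 'a \<Rightarrow> nat" where
  "word_length G A g = (LEAST n. \<exists>ws. length ws = n \<and> is_word G A ws g)"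

definition word_dist :: "('a, 'm) monoid_scheme \<Rightarrow> 'a set \<Rightarrow> 'a \<Rightarrow> 'a \<Rightarrow> real" where
  "word_dist G A x y = real (word_length G A (inv\<^bsub>G\<^esub> x \<otimes>\<^bsub>G\<^esub> y))"

definition finite_generating_set :: "('a, 'm) monoid_scheme \<Rightarrow> 'a set \<Rightarrow> bool" where
  "finite_generating_set G A \<longleftrightarrow>
     finite A \<and> A \<subseteq> carrier G \<and> generate G A = carrier G"

definition Gromov_product :: "('a \<Rightarrow> 'a \<Rightarrow> real) \<Rightarrow> 'a \<Rightarrow> 'a \<Rightarrow> 'a \<Rightarrow> real" where
  "Gromov_product d w x y = (d x w + d y w - d x y) / 2"

text \<open>Gromov's definition of a hyperbolic metric space, which does not require the space
  to be geodesic and so applies to a group with a word metric.\<close>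

definition Gromov_hyperbolic :: "'a set \<Rightarrow> ('a \<Rightarrow> 'a \<Rightarrow> real) \<Rightarrow> bool" where
  "Gromov_hyperbolic M d \<longleftrightarrow>
     (\<exists>\<delta>\<ge>0. \<forall>w\<in>M. \<forall>x\<in>M. \<forall>y\<in>M. \<forall>z\<in>M.
        Gromov_product d w x z
          \<ge> min (Gromov_product d w x y) (Gromov_product d w y z) - \<delta>)"

text \<open>Hyperbolicity does not depend on the choice of the finite generating set.\<close>

definition hyperbolic_group :: "('a, 'm) monoid_scheme \<Rightarrow> bool" where
  "hyperbolic_group G \<longleftrightarrow>
     group G \<and>
     (\<exists>A. finite_generating_set G A \<and> Gromov_hyperbolic (carrier G) (word_dist G A))"

text \<open>The map \<open>f\<close> is a quasiisometry between \<open>S\<close> and \<open>f ` S\<close>; coarse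
  surjectivity onto the image is automatic.\<close>

definition quasi_isometry_onto_image ::
  "'a set \<Rightarrow> ('a \<Rightarrow> 'a \<Rightarrow> real) \<Rightarrow> ('b \<Rightarrow> 'b \<Rightarrow> real) \<Rightarrow> ('a \<Rightarrow> 'b) \<Rightarrow> bool" where
  "quasi_isometry_onto_image S d d' f \<longleftrightarrow>
     (\<exists>K\<ge>1. \<exists>C\<ge>0. \<forall>u\<in>S. \<forall>v\<in>S.
        inverse K * d u v - C \<le> d' (f u) (f v) \<and> d' (f u) (f v) \<le> K * d u v + C)"

text \<open>The index condition is stated as finiteness of the set of cosets, because \<open>card\<close>
  would be 0 for infinite index.\<close>

definition quasiretract :: "'a set \<Rightarrow> ('a, 'm) monoid_scheme \<Rightarrow> bool" where
  "quasiretract H G \<longleftrightarrow>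
     subgroup H G \<and>
     (\<exists>N. N \<lhd> G \<and> finite (rcosets\<^bsub>G\<^esub> (H <#>\<^bsub>G\<^esub> N)) \<and> finite (H \<inter> N))"

end

theory Submission
  imports Defs
begin

text \<open>Take \<open>N\<close> to be the kernel of \<open>\<phi>\<close>; then \<open>H N = G\<close>. If \<open>h = p\<^sub>1 q\<^sub>1\<inverse> q\<^sub>2 p\<^sub>2\<close> lies in
  \<open>H \<inter> N\<close>, then \<open>\<phi>(q\<^sub>1)\<inverse> \<phi>(q\<^sub>2) = \<phi>(p\<^sub>1)\<inverse> \<phi>(p\<^sub>2)\<inverse>\<close> takes only finitely many values, so
  \<open>d\<^sub>1(\<phi>(q\<^sub>1), \<phi>(q\<^sub>2))\<close> is bounded. The lower quasiisometry inequality bounds \<open>d(q\<^sub>1, q\<^sub>2)\<close>, and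
  balls of \<open>G\<close> are finite.\<close>

lemma (in group) foldr_mult_append:
  assumes "set xs \<subseteq> carrier G" and "set ys \<subseteq> carrier G"
  shows "foldr (\<otimes>) (xs @ ys) \<one> = foldr (\<otimes>) xs \<one> \<otimes> foldr (\<otimes>) ys \<one>"
proof -
  \<comment> \<open>Associativity in \<open>G\<close> holds only inside the carrier, so the values
    of the two words have to be placed there first.\<close>
  have closed: "foldr (\<otimes>) zs \<one> \<in> carrier G" if "set zs \<subseteq> carrier G" for zs
    using that by (induction zs) auto
  show ?thesis
    using assms by (induction xs) (auto simp: closed m_assoc)
qed

text \<open>Ensures that the \<open>LEAST\<close> in \<open>word_length\<close> is attained on
  generated elements. In the induction over \<open>generate\<close>, a product is represented by
  concatenating words of its factors.\<close>

lemma (in group) is_word_exists: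
  assumes "A \<subseteq> carrier G" and "g \<in> generate G A"
  shows "\<exists>ws. is_word G A ws g"
  using assms(2)
proof (induction rule: generate.induct)
  case one
  show ?case by (rule exI[of _ "[]"]) (simp add: is_word_def)
next
  case (incl h)
  with assms(1) show ?case by (intro exI[of _ "[h]"]) (auto simp: is_word_def)
next
  case (inv h)
  with assms(1) show ?case by (intro exI[of _ "[inv h]"]) (auto simp: is_word_def SET_INV_def)
next
  case (eng h1 h2)
  then obtain xs ys where "is_word G A xs h1" "is_word G A ys h2" by blast
  moreover have "A \<union> set_inv A \<subseteq> carrier G" using assms(1) by (auto simp: SET_INV_def)
  ultimately have "is_word G A (xs @ ys) (h1 \<otimes> h2)"
    unfolding is_word_def using foldr_mult_append[of xs ys] by auto
  then show ?case by blast
qed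

text \<open>Each element of the ball is the value of a shortest word, and a finite alphabet admits
  only finitely many words of length at most \<open>n\<close>.\<close>

lemma (in group) finite_word_ball:
  assumes "finite_generating_set G A"
  shows "finite {g \<in> carrier G. word_length G A g \<le> n}"
proof (rule finite_subset)
  have A: "finite A" "A \<subseteq> carrier G" "generate G A = carrier G"
    using assms by (auto simp: finite_generating_set_def)
  let ?W = "{ws. set ws \<subseteq> A \<union> set_inv A \<and> length ws \<le> n}"
  show "finite ((\<lambda>ws. foldr (\<otimes>) ws \<one>) ` ?W)"
    using A(1) by (intro finite_imageI finite_lists_length_le) (simp add: SET_INV_def)
  show "{g \<in> carrier G. word_length G A g \<le> n} \<subseteq> (\<lambda>ws. foldr (\<otimes>) ws \<one>) ` ?W"
  proof clarify
    fix g assume g: "g \<in> carrier G" "word_length G A g \<le> n"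
    have "\<exists>m ws. length ws = m \<and> is_word G A ws g"
      using is_word_exists[OF A(2)] g(1) A(3) by auto
    then have "\<exists>ws. length ws = word_length G A g \<and> is_word G A ws g"
      unfolding word_length_def by (rule LeastI_ex)
    with g(2) show "g \<in> (\<lambda>ws. foldr (\<otimes>) ws \<one>) ` ?W"
      by (auto simp: is_word_def)
  qed
qed

text \<open>Given \<open>g\<close>, some \<open>k\<close> in \<open>K\<close> has the same image, so
  \<open>g\<close> differs from \<open>k\<close> by the kernel element
  \<open>inv k \<otimes> g\<close>.\<close>

lemma (in group_hom) set_mult_kernel_eq_carrier:
  assumes "K \<subseteq> carrier G" and "h ` K = carrier H"
  shows "K <#> kernel G H h = carrier G"
proof
  show "K <#> kernel G H h \<subseteq> carrier G"
    using assms(1) by (auto simp: set_mult_def kernel_def)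
  show "carrier G \<subseteq> K <#> kernel G H h"
  proof
    fix g assume g: "g \<in> carrier G"
    then have "h g \<in> h ` K" using assms(2) by simp
    then obtain k where k: "k \<in> K" "h k = h g" by auto
    moreover from k assms(1) have kG: "k \<in> carrier G" by auto
    moreover have "inv k \<otimes> g \<in> kernel G H h"
      using kG g k(2) by (simp add: kernel_def)
    moreover have "g = k \<otimes> (inv k \<otimes> g)"
      using kG g by (simp add: G.m_assoc[symmetric])
    ultimately show "g \<in> K <#> kernel G H h"
      unfolding set_mult_def by blast
  qed
qed

lemma quasi_isometry_bounded_preimage:
  assumes "quasi_isometry_onto_image S d d' f"
  obtains R where "\<And>u v. \<lbrakk>u \<in> S; v \<in> S; d' (f u) (f v) \<le> r\<rbrakk> \<Longrightarrow> d u v \<le> R"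
proof -
  obtain K C where K: "K \<ge> 1"
    and lower: "\<And>u v. \<lbrakk>u \<in> S; v \<in> S\<rbrakk> \<Longrightarrow> inverse K * d u v - C \<le> d' (f u) (f v)"
    using assms unfolding quasi_isometry_onto_image_def by blast
  \<comment> \<open>This is the lower inequality solved for \<open>d u v\<close>; since
    \<open>K \<ge> 1\<close>, multiplying by \<open>K\<close> keeps the direction. The bound is
    uniform in \<open>u\<close> and \<open>v\<close>.\<close>
  have "d u v \<le> K * (r + C)" if "u \<in> S" "v \<in> S" "d' (f u) (f v) \<le> r" for u v
  proof -
    have "inverse K * d u v \<le> r + C" using lower[OF that(1,2)] that(3) by linarith
    with K show ?thesis by (simp add: field_simps)
  qed
  then show thesis by (rule that)
qed

lemma (in group_hom) finite_products_in_kernel: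
  assumes fg: "finite_generating_set G A"
    and Q: "Q \<subseteq> carrier G"
    and P1: "P1 \<subseteq> carrier G" "finite P1"
    and P2: "P2 \<subseteq> carrier G" "finite P2"
    and qi: "quasi_isometry_onto_image Q (word_dist G A) (word_dist H B) h"
  shows "finite ((P1 <#> set_inv Q <#> Q <#> P2) \<inter> kernel G H h)"
proof -
  \<comment> \<open>These are the values that membership in the kernel forces on the image of the
    middle factor \<open>inv u \<otimes> v\<close>.\<close>
  define F where "F = (\<lambda>(p, p'). inv\<^bsub>H\<^esub> (h p) \<otimes>\<^bsub>H\<^esub> inv\<^bsub>H\<^esub> (h p')) ` (P1 \<times> P2)"
  have "finite F" unfolding F_def using P1 P2 by auto
  then obtain r where r: "\<And>x. x \<in> F \<Longrightarrow> word_length H B x \<le> r"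
    by (meson finite_imageI finite_nat_set_iff_bounded_le imageI)
  obtain R where
    R: "\<And>u v. \<lbrakk>u \<in> Q; v \<in> Q; word_dist H B (h u) (h v) \<le> real r\<rbrakk> \<Longrightarrow> word_dist G A u v \<le> R"
    using quasi_isometry_bounded_preimage[OF qi] by blast
  \<comment> \<open>Word lengths are natural numbers, so a length at most the real number
    \<open>R\<close> is at most its floor.\<close>
  define D where "D = {g \<in> carrier G. word_length G A g \<le> nat \<lfloor>R\<rfloor>}"
  have "finite D" unfolding D_def by (rule G.finite_word_ball[OF fg])
  \<comment> \<open>Infinitely many pairs \<open>u\<close>, \<open>v\<close> may occur, but the
    product depends on them only through \<open>inv u \<otimes> v\<close>, which is confined to the
    finite set \<open>D\<close>.\<close>
  have "(P1 <#> set_inv Q <#> Q <#> P2) \<inter> kernel G H h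
      \<subseteq> (\<lambda>(p, g, p'). p \<otimes> g \<otimes> p') ` (P1 \<times> D \<times> P2)"
  proof
    fix x assume x: "x \<in> (P1 <#> set_inv Q <#> Q <#> P2) \<inter> kernel G H h"
    then obtain p u v p' where elems: "p \<in> P1" "u \<in> Q" "v \<in> Q" "p' \<in> P2"
      and x_eq: "x = p \<otimes> inv u \<otimes> v \<otimes> p'"
      by (auto simp: set_mult_def SET_INV_def)
    have car: "p \<in> carrier G" "u \<in> carrier G" "v \<in> carrier G" "p' \<in> carrier G"
      using elems P1(1) P2(1) Q by auto
    have x_eq': "x = p \<otimes> (inv u \<otimes> v) \<otimes> p'" using car by (simp add: x_eq G.m_assoc)
    define y where "y = inv\<^bsub>H\<^esub> (h u) \<otimes>\<^bsub>H\<^esub> h v"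
    have y: "y \<in> carrier H" unfolding y_def using car by simp
    \<comment> \<open>The image of \<open>x\<close> is trivial; cancelling \<open>h p'\<close> on
      the right and \<open>h p\<close> on the left then isolates \<open>y\<close>.\<close>
    have "h p \<otimes>\<^bsub>H\<^esub> y \<otimes>\<^bsub>H\<^esub> h p' = \<one>\<^bsub>H\<^esub>"
      using x car by (simp add: x_eq' y_def kernel_def)
    then have "h p \<otimes>\<^bsub>H\<^esub> y = inv\<^bsub>H\<^esub> (h p')"
      using car y by (metis H.inv_equality H.inv_inv H.m_closed hom_closed)
    then have "y = inv\<^bsub>H\<^esub> (h p) \<otimes>\<^bsub>H\<^esub> inv\<^bsub>H\<^esub> (h p')"
      using car y by (metis H.inv_solve_left H.inv_closed hom_closed)
    then have "y \<in> F" unfolding F_def using elems by auto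
    then have "word_dist H B (h u) (h v) \<le> real r"
      using r by (simp add: word_dist_def y_def)
    then have "word_dist G A u v \<le> R" using R elems by blast
    then have "inv u \<otimes> v \<in> D"
      using car by (simp add: D_def word_dist_def le_nat_floor)
    with elems x_eq' show "x \<in> (\<lambda>(p, g, p'). p \<otimes> g \<otimes> p') ` (P1 \<times> D \<times> P2)"
      by force
  qed
  moreover have "finite (P1 \<times> D \<times> P2)" using P1 P2 \<open>finite D\<close> by simp
  ultimately show ?thesis by (meson finite_imageI finite_subset)
qed

theorem theorem2:
  fixes G :: "('a, 'm) monoid_scheme"
    and G\<^sub>1 :: "('b, 'n) monoid_scheme"
    and A H Q P\<^sub>1 P\<^sub>2 :: "'a set"
    and \<phi> :: "'a \<Rightarrow> 'b"
  assumes "hyperbolic_group G"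
    and "finite_generating_set G A" and "set_inv\<^bsub>G\<^esub> A = A"
    and "subgroup H G" and "infinite H"
    and "Q \<subseteq> carrier G"
    and "P\<^sub>1 \<subseteq> carrier G" and "finite P\<^sub>1"
    and "P\<^sub>2 \<subseteq> carrier G" and "finite P\<^sub>2"
    and "H \<subseteq> P\<^sub>1 <#>\<^bsub>G\<^esub> set_inv\<^bsub>G\<^esub> Q <#>\<^bsub>G\<^esub> Q <#>\<^bsub>G\<^esub> P\<^sub>2"
    and "group G\<^sub>1"
    and "\<phi> \<in> epi G G\<^sub>1"
    and "\<phi> ` H = carrier G\<^sub>1"
    and "quasi_isometry_onto_image Q (word_dist G A) (word_dist G\<^sub>1 (\<phi> ` A)) \<phi>"
  shows "quasiretract H G"
proof -
  interpret G: group G using assms(1) by (simp add: hyperbolic_group_def)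
  interpret G1: group G\<^sub>1 by fact
  interpret group_hom G G\<^sub>1 \<phi>
    using assms(13) by unfold_locales (simp add: epi_def)
  let ?N = "kernel G G\<^sub>1 \<phi>"
  have H: "H \<subseteq> carrier G" using assms(4) by (rule subgroup.subset)
  have "H <#>\<^bsub>G\<^esub> ?N = carrier G"
    using H assms(14) by (rule set_mult_kernel_eq_carrier)
  \<comment> \<open>Every coset of the whole group is the group itself, so the index of
    \<open>H <#> ?N\<close> is 1.\<close>
  moreover have "rcosets\<^bsub>G\<^esub> (carrier G) \<subseteq> {carrier G}"
    using G.coset_join2[OF _ G.subgroup_self] by (auto simp: RCOSETS_def)
  ultimately have "finite (rcosets\<^bsub>G\<^esub> (H <#>\<^bsub>G\<^esub> ?N))"
    by (simp add: finite_subset)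
  \<comment> \<open>The covering of \<open>H\<close> by products places this intersection inside the
    finite set of products lying in the kernel.\<close>
  moreover have "finite (H \<inter> ?N)"
    using finite_products_in_kernel[OF assms(2,6-10,15)] assms(11)
    by (meson Int_mono finite_subset order_refl)
  ultimately show ?thesis
    unfolding quasiretract_def using assms(4) normal_kernel by blast
qed

end
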